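(* Let $\mathbb{F}$ be a field. Any nonzero multiple $g\cdot x_1\cdots x_n$ (with $0\ne g\in\mathbb{F}[x_1,\ldots,x_n]$) of the monomial $x_1\cdots x_n$ requires size $\ge2^n$ to be computed as a $\sum\bigwedge\sum$ formula.
   Context: A $\sum\bigwedge\sum$ (depth-3 powering) formula in $x_1,\ldots,x_n$ is an expression $\sum_{i=1}^s\ell_i(\overline{x})^{d_i}$ with $\ell_i$ affine linear functions over $\mathbb{F}$; its size is $n\cdot\sum_{i=1}^s(d_i+1)$. *)

theory Defs
  imports "HOL-Library.Poly_Mapping"
begin

text \<open>Polynomials in variables indexed by \<^typ>\<open>nat\<close>, as finitely supported maps from exponent
  vectors to coefficients; the ring structure on \<^type>\<open>poly_mapping\<close> (convolution product) is the
  usual one.\<close>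

type_synonym 'a mpoly = "(nat \<Rightarrow>\<^sub>0 nat) \<Rightarrow>\<^sub>0 'a"

definition Const :: "'a::zero \<Rightarrow> 'a mpoly"
  where "Const c = Poly_Mapping.single 0 c"

definition Var :: "nat \<Rightarrow> 'a::zero_neq_one mpoly"
  where "Var i = Poly_Mapping.single (Poly_Mapping.single i 1) 1"

text \<open>The carrier of $F[x_1,\ldots,x_n]$; the variables are numbered from 1.\<close>

definition mpolys :: "nat \<Rightarrow> 'a::zero mpoly set"
  where "mpolys n = {p. \<forall>m \<in> Poly_Mapping.keys p. Poly_Mapping.keys m \<subseteq> {1..n}}"

definition affine_linear :: "nat \<Rightarrow> 'a::comm_ring_1 mpoly \<Rightarrow> bool"
  where "affine_linear n l \<longleftrightarrow>
    (\<exists>b a. l = Const b + (\<Sum>i = 1..n. Const (a i) * Var i))"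

text \<open>The depth-3 powering formula $\sum_{i=1}^s \ell_i^{d_i}$ is given by the list of the pairs
  $(\ell_i, d_i)$. Its size depends on this list, not just on the polynomial computed.\<close>

type_synonym 'a powering_formula = "('a mpoly \<times> nat) list"

definition powering_formula :: "nat \<Rightarrow> 'a::comm_ring_1 powering_formula \<Rightarrow> bool"
  where "powering_formula n F \<longleftrightarrow> (\<forall>(l, d) \<in> set F. affine_linear n l)"

definition computed_poly :: "'a::comm_ring_1 powering_formula \<Rightarrow> 'a mpoly"
  where "computed_poly F = (\<Sum>(l, d) \<leftarrow> F. l ^ d)"

definition formula_size :: "nat \<Rightarrow> 'a::comm_ring_1 powering_formula \<Rightarrow> nat"
  where "formula_size n F = n * (\<Sum>(l, d) \<leftarrow> F. d + 1)"

end

theory Submission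
  imports Defs Complex_Main
begin

text \<open>Consider the space \<open>V\<close> spanned by the powers \<open>\<ell>\<^sub>i ^ j\<close> with \<open>j \<le> d\<^sub>i\<close>. It contains the
  computed polynomial and is closed under the Hasse derivatives, because a derivative of \<open>\<ell> ^ d\<close>
  of order \<open>k\<close> in one variable is a scalar multiple of \<open>\<ell> ^ (d - k)\<close>. The Hasse derivative in
  \<open>x\<^sub>i\<close> whose order is the exponent of \<open>x\<^sub>i\<close> in the leading monomial erases \<open>x\<^sub>i\<close> from that
  monomial; its coefficient is multiplied by a binomial coefficient equal to 1, so this works in
  every characteristic. The leading monomial of a multiple of \<open>x\<^sub>1 \<cdots> x\<^sub>n\<close> involves all
  variables, hence erasing subsets of the variables yields \<open>2 ^ n\<close> leading monomials of elements of
  \<open>V\<close>, while their number is at most \<open>dim V \<le> \<Sum>\<^sub>i (d\<^sub>i + 1)\<close>.\<close>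

section \<open>Hasse derivatives\<close>

text \<open>The divided derivative of order \<open>k\<close> in the variable \<open>i\<close>, that
  is, the \<open>k\<close>-fold partial derivative over \<open>k!\<close>. Binomial coefficients
  replace the division, so it makes sense in every characteristic.\<close>

lift_definition hasse :: "nat \<Rightarrow> nat \<Rightarrow> 'a::semiring_1 mpoly \<Rightarrow> 'a mpoly"
  is "\<lambda>i k p m. of_nat ((Poly_Mapping.lookup m i + k) choose k) * p (m + Poly_Mapping.single i k)"
proof -
  fix i k :: nat and p :: "(nat \<Rightarrow>\<^sub>0 nat) \<Rightarrow> 'a"
  assume "finite {m. p m \<noteq> 0}"
  then have "finite ((\<lambda>m. m + Poly_Mapping.single i k) -` {m. p m \<noteq> 0})"
    by (rule finite_vimageI) (auto simp: inj_def)
  then show "finite {m. of_nat ((Poly_Mapping.lookup m i + k) choose k)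
      * p (m + Poly_Mapping.single i k) \<noteq> 0}"
    by (rule rev_finite_subset) auto
qed

lemma hasse_0_left [simp]: "hasse i 0 p = p"
  by (rule poly_mapping_eqI) (simp add: hasse.rep_eq)

lemma hasse_zero [simp]: "hasse i k 0 = 0"
  by (rule poly_mapping_eqI) (simp add: hasse.rep_eq)

lemma hasse_add: "hasse i k (p + q) = hasse i k p + hasse i k q"
  by (rule poly_mapping_eqI) (simp add: hasse.rep_eq lookup_add distrib_left)

lemma hasse_sum: "hasse i k (sum f A) = (\<Sum>x\<in>A. hasse i k (f x))"
  by (induction A rule: infinite_finite_induct) (simp_all add: hasse_add)

lemma hasse_1: "hasse i k 1 = (if k = 0 then 1 else 0)"
proof (cases k)
  case (Suc k')
  have "m + Poly_Mapping.single i (Suc k') \<noteq> 0" for m :: "nat \<Rightarrow>\<^sub>0 nat"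
  proof
    assume "m + Poly_Mapping.single i (Suc k') = 0"
    then have "Poly_Mapping.lookup (m + Poly_Mapping.single i (Suc k')) i = 0"
      by simp
    then show False
      by (simp add: lookup_add)
  qed
  with Suc show ?thesis
    by (intro poly_mapping_eqI) (simp add: hasse.rep_eq lookup_one)
qed simp

section \<open>Products with constants and variables\<close>

lemma lookup_Const_mult:
  fixes c :: "'a::semiring_1"
  shows "Poly_Mapping.lookup (Const c * p) m = c * Poly_Mapping.lookup p m"
  by (simp add: Const_def mult_map_scale_conv_mult [symmetric] map.rep_eq when_def)

lemma hasse_Const_mult:
  fixes c :: "'a::comm_semiring_1"
  shows "hasse i k (Const c * p) = Const c * hasse i k p"
  by (rule poly_mapping_eqI) (simp add: hasse.rep_eq lookup_Const_mult mult.left_commute)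

lemma lookup_single_mult:
  fixes p :: "'a::semiring_1 mpoly"
  shows "Poly_Mapping.lookup (Poly_Mapping.single t c * p) m
    = (\<Sum>q. c * Poly_Mapping.lookup p q when m = t + q)"
proof -
  have "Poly_Mapping.lookup (Poly_Mapping.single t c * p) m =
      (\<Sum>l. (c * (\<Sum>q. Poly_Mapping.lookup p q when m = l + q)) when l = t)"
    unfolding lookup_mult lookup_single by (intro Sum_any.cong) (auto simp: when_def)
  also have "\<dots> = c * (\<Sum>q. Poly_Mapping.lookup p q when m = t + q)"
    by simp
  also have "\<dots> = (\<Sum>q. c * (Poly_Mapping.lookup p q when m = t + q))"
    by (rule Sum_any_right_distrib)
      (rule finite_subset [OF _ finite_lookup [of p]], auto simp: when_def)
  finally show ?thesis
    by (simp add: mult_when)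
qed

lemma lookup_Var_mult_add:
  fixes p :: "'a::semiring_1 mpoly"
  shows "Poly_Mapping.lookup (Var j * p) (m + Poly_Mapping.single j 1) = Poly_Mapping.lookup p m"
  by (simp add: Var_def lookup_single_mult add.commute [of _ "Poly_Mapping.single j _"])

lemma lookup_Var_mult_eq_0:
  fixes p :: "'a::semiring_1 mpoly"
  assumes "Poly_Mapping.lookup m j = 0"
  shows "Poly_Mapping.lookup (Var j * p) m = 0"
proof -
  have "m \<noteq> Poly_Mapping.single j 1 + q" for q
    using assms by (auto simp: lookup_add)
  then show ?thesis
    by (simp add: Var_def lookup_single_mult)
qed

text \<open>These are the two cases in which a coefficient of \<open>Var j * p\<close> can be read
  off: it vanishes, or it is a coefficient of \<open>p\<close>.\<close>

lemma monom_cases: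
  fixes m :: "nat \<Rightarrow>\<^sub>0 nat"
  obtains "Poly_Mapping.lookup m j = 0" | m' where "m = m' + Poly_Mapping.single j 1"
proof (cases "Poly_Mapping.lookup m j = 0")
  case False
  then have "m = (m - Poly_Mapping.single j 1) + Poly_Mapping.single j 1"
    by (intro poly_mapping_eqI) (auto simp: lookup_add lookup_minus lookup_single when_def)
  then show ?thesis using that by blast
qed (use that in blast)

text \<open>The binomial factor depends only on the exponent of variable \<open>i\<close>, which
  multiplication by another variable leaves unchanged.\<close>

lemma hasse_Var_mult_neq:
  fixes p :: "'a::semiring_1 mpoly"
  assumes "i \<noteq> j"
  shows "hasse i k (Var j * p) = Var j * hasse i k p"
proof (rule poly_mapping_eqI)
  fix m
  show "Poly_Mapping.lookup (hasse i k (Var j * p)) m = Poly_Mapping.lookup (Var j * hasse i k p) m"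
  proof (cases m rule: monom_cases [of _ j])
    case 1
    then show ?thesis
      using assms by (simp add: hasse.rep_eq lookup_Var_mult_eq_0 lookup_add lookup_single)
  next
    case (2 m')
    have "m' + Poly_Mapping.single j 1 + Poly_Mapping.single i k
        = (m' + Poly_Mapping.single i k) + Poly_Mapping.single j 1"
      by (simp add: ac_simps)
    with 2 show ?thesis
      using assms
      by (simp only: hasse.rep_eq lookup_Var_mult_add lookup_add lookup_single) simp
  qed
qed

text \<open>Leibniz rule: \<open>Var i\<close> itself has nonzero derivatives of orders 0 and 1
  only, hence two terms. On coefficients it is Pascal's rule.\<close>

lemma hasse_Var_mult_same:
  fixes p :: "'a::semiring_1 mpoly"
  shows "hasse i (Suc k) (Var i * p) = Var i * hasse i (Suc k) p + hasse i k p"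
proof (rule poly_mapping_eqI)
  fix m
  have shift: "q + Poly_Mapping.single i (Suc k)
      = (q + Poly_Mapping.single i k) + Poly_Mapping.single i 1" for q
    by (simp add: add.assoc single_add [symmetric])
  show "Poly_Mapping.lookup (hasse i (Suc k) (Var i * p)) m =
      Poly_Mapping.lookup (Var i * hasse i (Suc k) p + hasse i k p) m"
  proof (cases m rule: monom_cases [of _ i])
    case 1
    \<comment> \<open>With exponent 0 the first summand on the right vanishes, and the binomial
      coefficients of the other two terms are both 1.\<close>
    then show ?thesis
      by (simp only: lookup_add hasse.rep_eq lookup_Var_mult_eq_0 shift lookup_Var_mult_add) simp
  next
    case (2 m')
    have "m' + Poly_Mapping.single i 1 + Poly_Mapping.single i k
        = m' + Poly_Mapping.single i (Suc k)"
      by (simp add: add.assoc single_add [symmetric])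
    \<comment> \<open>The exponent of variable \<open>i\<close> in \<open>m'\<close> is one less
      than in \<open>m\<close>, which turns \<open>Suc k\<close> into \<open>k\<close> in the upper
      entry of the binomial.\<close>
    then have "Poly_Mapping.lookup (Var i * hasse i (Suc k) p) m
        = of_nat ((Poly_Mapping.lookup m i + k) choose Suc k)
          * Poly_Mapping.lookup p (m + Poly_Mapping.single i k)"
      using 2 lookup_Var_mult_add [of i "hasse i (Suc k) p" m']
      by (simp add: hasse.rep_eq lookup_add)
    moreover have "Poly_Mapping.lookup (hasse i (Suc k) (Var i * p)) m
        = of_nat ((Poly_Mapping.lookup m i + Suc k) choose Suc k)
          * Poly_Mapping.lookup p (m + Poly_Mapping.single i k)"
      by (simp only: hasse.rep_eq shift lookup_Var_mult_add)
    ultimately show ?thesis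
      by (simp add: hasse.rep_eq lookup_add distrib_right add.commute)
  qed
qed

section \<open>Derivatives of powers of affine linear polynomials\<close>

lemma Const_0 [simp]: "Const 0 = 0"
  by (simp add: Const_def)

lemma Const_1 [simp]: "Const 1 = 1"
  by (simp add: Const_def)

lemma Const_add: "Const (a + b) = Const a + Const b"
  by (simp add: Const_def single_add)

lemma Const_mult: "Const (a * b) = Const a * Const b"
  by (simp add: Const_def mult_single)

text \<open>Leibniz rule again: the first derivative of \<open>l\<close> is a constant and the
  higher ones vanish. The same \<open>c\<close> serves all \<open>k\<close> and \<open>p\<close>, as
  the induction on powers requires.\<close>

lemma hasse_Suc_affine_linear_mult:
  assumes "affine_linear n l"
  obtains c where "\<And>k p. hasse i (Suc k) (l * p) = l * hasse i (Suc k) p + Const c * hasse i k p"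
proof -
  obtain b a where l: "l = Const b + (\<Sum>j = 1..n. Const (a j) * Var j)"
    using assms unfolding affine_linear_def by blast
  \<comment> \<open>The first derivative of \<open>l\<close> in variable \<open>i\<close>; it is 0
    if that variable is outside the range of the sum, where \<open>a i\<close> is arbitrary.\<close>
  define c where "c = (if i \<in> {1..n} then a i else 0)"
  have "hasse i (Suc k) (l * p) = l * hasse i (Suc k) p + Const c * hasse i k p" for k p
  proof -
    have summand: "hasse i (Suc k) (Const (a j) * Var j * p)
        = Const (a j) * Var j * hasse i (Suc k) p
          + (if j = i then Const (a i) * hasse i k p else 0)" for j
      by (simp add: mult.assoc hasse_Const_mult hasse_Var_mult_neq hasse_Var_mult_same distrib_left)
    have "hasse i (Suc k) (l * p) = Const b * hasse i (Suc k) p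
        + (\<Sum>j = 1..n. hasse i (Suc k) (Const (a j) * Var j * p))"
      unfolding l by (simp add: distrib_right sum_distrib_right hasse_add hasse_sum hasse_Const_mult)
    also have "\<dots> = l * hasse i (Suc k) p + Const c * hasse i k p"
      unfolding summand l c_def
      by (simp add: sum.distrib distrib_right sum_distrib_right)
    finally show ?thesis .
  qed
  then show ?thesis using that by blast
qed

text \<open>For \<open>k > d\<close> the truncated exponent \<open>d - k\<close> is harmless because \<open>d choose k = 0\<close>.\<close>

lemma hasse_affine_linear_power:
  assumes "affine_linear n l"
  obtains c where "\<And>k d. hasse i k (l ^ d) = Const (of_nat (d choose k) * c ^ k) * l ^ (d - k)"
proof -
  obtain c where c: "\<And>k p. hasse i (Suc k) (l * p) = l * hasse i (Suc k) p + Const c * hasse i k p"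
    using hasse_Suc_affine_linear_mult [OF assms] by blast
  have "hasse i k (l ^ d) = Const (of_nat (d choose k) * c ^ k) * l ^ (d - k)" for k d
  proof (induction d arbitrary: k)
    case 0
    then show ?case by (cases k) (simp_all add: hasse_1)
  next
    case (Suc d)
    show ?case
    proof (cases k)
      case (Suc k')
      have first: "l * hasse i (Suc k') (l ^ d)
          = Const (of_nat (d choose Suc k') * c ^ Suc k') * l ^ (d - k')"
      \<comment> \<open>For \<open>k' \<ge> d\<close> both truncated exponents are 0, so the factor
        \<open>l\<close> cannot be absorbed; there the binomial coefficient makes both sides
        0.\<close>
      proof (cases "k' < d")
        case True
        then have "l ^ (d - k') = l * l ^ (d - Suc k')"
          by (simp flip: power_Suc add: Suc_diff_Suc)
        then show ?thesis
          by (simp only: Suc.IH mult.left_commute)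
      next
        case False
        then show ?thesis
          unfolding Suc.IH by (simp add: binomial_eq_0)
      qed
      have second: "Const c * hasse i k' (l ^ d)
          = Const (of_nat (d choose k') * c ^ Suc k') * l ^ (d - k')"
        unfolding Suc.IH by (simp add: Const_mult ac_simps)
      have "hasse i k (l ^ Suc d) = l * hasse i (Suc k') (l ^ d) + Const c * hasse i k' (l ^ d)"
        by (simp add: Suc c)
      also have "\<dots> = Const (of_nat (d choose Suc k') * c ^ Suc k' + of_nat (d choose k') * c ^ Suc k')
          * l ^ (d - k')"
        unfolding first second by (simp only: Const_add distrib_right)
      \<comment> \<open>Pascal's rule merges the two binomials into
        \<open>Suc d choose Suc k'\<close>.\<close>
      finally show ?thesis
        by (simp add: Suc distrib_right add.commute)
    qed simp
  qed
  then show ?thesis using that by blast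
qed

section \<open>Leading monomials\<close>

text \<open>Exponent vectors are ordered lexicographically, a linear order compatible with addition.
  For the zero polynomial the value is unspecified.\<close>

abbreviation lead_monom :: "'a::zero mpoly \<Rightarrow> nat \<Rightarrow>\<^sub>0 nat"
  where "lead_monom p \<equiv> Max (Poly_Mapping.keys p)"

lemma lookup_lead_monom:
  assumes "p \<noteq> 0"
  shows "Poly_Mapping.lookup p (lead_monom p) \<noteq> 0"
  using Max_in [of "Poly_Mapping.keys p"] assms by (simp add: in_keys_iff)

lemma lead_monom_eqI:
  assumes "Poly_Mapping.lookup p m \<noteq> 0"
    and "\<And>m'. Poly_Mapping.lookup p m' \<noteq> 0 \<Longrightarrow> m' \<le> m"
  shows "lead_monom p = m"
  using assms by (intro Max_eqI) (auto simp: in_keys_iff)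

lemma lookup_eq_0_if_gt_lead_monom:
  assumes "lead_monom p < m"
  shows "Poly_Mapping.lookup p m = 0"
  using assms by (meson Max_ge finite_keys in_keys_iff not_le)

text \<open>Each monomial of the derivative is a monomial of \<open>p\<close> with a fixed vector
  subtracted. Translation preserves the order, so the leading monomial stays in front provided its
  coefficient survives.\<close>

lemma lead_monom_hasse:
  fixes p :: "'a::semiring_1 mpoly" and i :: nat
  assumes "p \<noteq> 0"
  defines "k \<equiv> Poly_Mapping.lookup (lead_monom p) i"
  shows "hasse i k p \<noteq> 0"
    and "lead_monom (hasse i k p) = lead_monom p - Poly_Mapping.single i k"
proof -
  let ?a = "lead_monom p - Poly_Mapping.single i k"
  have a: "?a + Poly_Mapping.single i k = lead_monom p"
    by (intro poly_mapping_eqI)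
      (auto simp: k_def lookup_add lookup_minus lookup_single when_def)
  \<comment> \<open>Since variable \<open>i\<close> is erased completely, the binomial factor at
    \<open>?a\<close> is \<open>k choose k = 1\<close>.\<close>
  have "Poly_Mapping.lookup ?a i = 0"
    by (simp add: lookup_minus k_def)
  then have nz: "Poly_Mapping.lookup (hasse i k p) ?a \<noteq> 0"
    using lookup_lead_monom [OF assms(1)] by (simp add: hasse.rep_eq a)
  then show "hasse i k p \<noteq> 0"
    by auto
  have "m \<le> ?a" if "Poly_Mapping.lookup (hasse i k p) m \<noteq> 0" for m
  proof -
    have "Poly_Mapping.lookup p (m + Poly_Mapping.single i k) \<noteq> 0"
      using that by (auto simp: hasse.rep_eq)
    then have "m + Poly_Mapping.single i k \<le> ?a + Poly_Mapping.single i k"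
      unfolding a using lookup_eq_0_if_gt_lead_monom not_le by blast
    then show ?thesis
      by simp
  qed
  with nz show "lead_monom (hasse i k p) = ?a"
    by (rule lead_monom_eqI)
qed

section \<open>Leading monomials and dimension\<close>

interpretation mpoly: vector_space "\<lambda>(c::'a::field) (p::'a mpoly). Const c * p"
  by unfold_locales (simp_all add: Const_add Const_mult algebra_simps)

text \<open>In a linear relation, the largest leading monomial among the terms with nonzero
  coefficient occurs in only one of them, so it cannot cancel.\<close>

lemma independent_if_inj_on_lead_monom:
  fixes B :: "'a::field mpoly set"
  assumes "0 \<notin> B" and inj: "inj_on lead_monom B"
  shows "mpoly.independent B"
  unfolding mpoly.independent_explicit_finite_subsets
proof (intro allI impI ballI)
  fix S u v
  assume "S \<subseteq> B" and fin: "finite S" and sum0: "(\<Sum>v\<in>S. Const (u v) * v) = 0" and "v \<in> S"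
  show "u v = 0"
  proof (rule ccontr)
    assume "u v \<noteq> 0"
    define T where "T = {w \<in> S. u w \<noteq> 0}"
    have "finite (lead_monom ` T)" "lead_monom ` T \<noteq> {}"
      using fin \<open>v \<in> S\<close> \<open>u v \<noteq> 0\<close> by (auto simp: T_def)
    then have "Max (lead_monom ` T) \<in> lead_monom ` T"
      by (rule Max_in)
    then obtain w where w: "w \<in> T" "lead_monom w = Max (lead_monom ` T)"
      unfolding image_iff by metis
    let ?m = "lead_monom w"
    have others: "u x * Poly_Mapping.lookup x ?m = 0" if "x \<in> S - {w}" for x
    proof (cases "u x = 0")
      case False
      with that have "x \<in> T"
        by (simp add: T_def)
      then have "lead_monom x \<le> ?m"
        unfolding w(2) using fin by (intro Max_ge) (auto simp: T_def)
      moreover have "lead_monom x \<noteq> ?m"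
        using inj that w(1) \<open>S \<subseteq> B\<close> by (auto simp: inj_on_def T_def)
      ultimately show ?thesis
        by (simp add: lookup_eq_0_if_gt_lead_monom)
    qed simp
    have "0 = Poly_Mapping.lookup (\<Sum>x\<in>S. Const (u x) * x) ?m"
      using sum0 by simp
    also have "\<dots> = (\<Sum>x\<in>S. u x * Poly_Mapping.lookup x ?m)"
      by (simp add: lookup_sum lookup_Const_mult)
    also have "\<dots> = u w * Poly_Mapping.lookup w ?m"
      using w(1) fin sum.neutral [of "S - {w}", OF ballI [OF others]]
      by (subst sum.remove [of _ w]) (auto simp: T_def)
    finally have "Poly_Mapping.lookup w ?m = 0"
      using w(1) by (simp add: T_def)
    moreover have "w \<noteq> 0"
      using w(1) \<open>S \<subseteq> B\<close> \<open>0 \<notin> B\<close> by (auto simp: T_def)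
    ultimately show False
      using lookup_lead_monom by blast
  qed
qed

text \<open>Choosing one element of the span for each leading monomial gives an independent set,
  whose size is bounded by that of any spanning set.\<close>

lemma card_lead_monom_span_le:
  fixes P :: "'a::field mpoly set"
  assumes "finite P"
  shows "finite (lead_monom ` (mpoly.span P - {0}))"
    and "card (lead_monom ` (mpoly.span P - {0})) \<le> card P"
proof -
  obtain B where B: "B \<subseteq> mpoly.span P - {0}" "inj_on lead_monom B"
    "lead_monom ` (mpoly.span P - {0}) = lead_monom ` B"
    by (meson subset_image_inj subset_refl)
  have "mpoly.independent B"
    using B by (intro independent_if_inj_on_lead_monom) auto
  then have "finite B \<and> card B \<le> card P"
    using B by (intro mpoly.independent_span_bound [OF assms]) auto
  then show "finite (lead_monom ` (mpoly.span P - {0}))"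
    and "card (lead_monom ` (mpoly.span P - {0})) \<le> card P"
    using B by (simp_all add: card_image)
qed

section \<open>Spans closed under Hasse derivatives\<close>

lemma hasse_in_span:
  fixes P :: "'a::field mpoly set"
  assumes "\<And>p. p \<in> P \<Longrightarrow> hasse i k p \<in> mpoly.span P" and "p \<in> mpoly.span P"
  shows "hasse i k p \<in> mpoly.span P"
  using assms(2)
proof (induction rule: mpoly.span_induct_alt)
  case base
  show ?case by (simp add: mpoly.span_zero)
next
  case (step c x y)
  then show ?case
    by (simp add: hasse_add hasse_Const_mult mpoly.span_add mpoly.span_scale assms(1))
qed

lemma power_card_le_if_hasse_closed:
  fixes P :: "'a::field mpoly set"
  assumes "finite P"
    and closed: "\<And>i k p. p \<in> P \<Longrightarrow> hasse i k p \<in> mpoly.span P"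
    and f: "f \<in> mpoly.span P" "f \<noteq> 0"
  shows "2 ^ card (Poly_Mapping.keys (lead_monom f)) \<le> card P"
proof -
  let ?V = "mpoly.span P - {0}"
  let ?K = "Poly_Mapping.keys (lead_monom f)"
  \<comment> \<open>Variables are erased one at a time. If \<open>i\<close> is already absent from
    the leading monomial, then \<open>k = 0\<close> and the derivative changes nothing.\<close>
  have erase: "\<exists>h \<in> ?V. Poly_Mapping.keys (lead_monom h) = ?K - S" if "finite S" for S
    using that
  proof induction
    case empty
    then show ?case using f by auto
  next
    case (insert i S)
    then obtain h where h: "h \<in> ?V" "Poly_Mapping.keys (lead_monom h) = ?K - S"
      by blast
    define k where "k = Poly_Mapping.lookup (lead_monom h) i"
    have "hasse i k h \<in> ?V"
      and "lead_monom (hasse i k h) = lead_monom h - Poly_Mapping.single i k"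
      using h(1) lead_monom_hasse [of h i] hasse_in_span [OF closed] by (auto simp: k_def)
    moreover have "Poly_Mapping.keys (lead_monom h - Poly_Mapping.single i k)
        = Poly_Mapping.keys (lead_monom h) - {i}"
      by (auto simp: k_def in_keys_iff lookup_minus lookup_single when_def split: if_splits)
    ultimately show ?case
      using h(2) by (intro bexI [of _ "hasse i k h"]) auto
  qed
  \<comment> \<open>Monomials are counted by their sets of variables: erasing \<open>?K - S\<close>
    leaves exactly \<open>S\<close>.\<close>
  have "Pow ?K \<subseteq> Poly_Mapping.keys ` lead_monom ` ?V"
  proof
    fix S
    assume "S \<in> Pow ?K"
    then have "S = ?K - (?K - S)"
      by blast
    with erase [of "?K - S"] show "S \<in> Poly_Mapping.keys ` lead_monom ` ?V"
      by (auto simp: image_image intro: rev_image_eqI)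
  qed
  then have "card (Pow ?K) \<le> card (lead_monom ` ?V)"
    using card_lead_monom_span_le(1) [OF \<open>finite P\<close>] by (rule surj_card_le [rotated])
  also have "\<dots> \<le> card P"
    by (rule card_lead_monom_span_le(2) [OF \<open>finite P\<close>])
  finally show ?thesis
    by (simp add: card_Pow)
qed

section \<open>Powering formulas\<close>

text \<open>Lower powers are included to absorb derivatives; counting from \<open>j = 0\<close>
  matches the weight \<open>d + 1\<close> of a summand in the size.\<close>

definition formula_powers :: "'a::comm_ring_1 powering_formula \<Rightarrow> 'a mpoly set"
  where "formula_powers F = (\<Union>(l, d) \<in> set F. (\<lambda>j. l ^ j) ` {..d})"

lemma finite_formula_powers: "finite (formula_powers F)"
  by (auto simp: formula_powers_def)

lemma card_formula_powers: "card (formula_powers F) \<le> (\<Sum>(l, d) \<leftarrow> F. d + 1)"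
proof (induction F)
  case (Cons x F)
  obtain l d where x: "x = (l, d)"
    by force
  have "card (formula_powers (x # F)) \<le> card ((\<lambda>j. l ^ j) ` {..d}) + card (formula_powers F)"
    by (simp add: formula_powers_def x card_Un_le)
  also have "\<dots> \<le> (d + 1) + card (formula_powers F)"
    using card_image_le [of "{..d}" "\<lambda>j. l ^ j"] by simp
  finally show ?case
    using Cons by (simp add: x)
qed (simp add: formula_powers_def)

lemma computed_poly_in_span: "computed_poly F \<in> mpoly.span (formula_powers F)"
proof -
  \<comment> \<open>The induction runs over a list \<open>G\<close> of summands of \<open>F\<close>,
    so that the span stays fixed.\<close>
  have "(\<Sum>(l, d) \<leftarrow> G. l ^ d) \<in> mpoly.span (formula_powers F)" if "set G \<subseteq> set F" for G
    using that
  proof (induction G)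
    case (Cons x G)
    obtain l d where x: "x = (l, d)"
      by force
    have "l ^ d \<in> formula_powers F"
      using Cons.prems by (force simp: formula_powers_def x)
    then show ?case
      using Cons by (simp add: x mpoly.span_add mpoly.span_base)
  qed (simp add: mpoly.span_zero)
  then show ?thesis
    by (simp add: computed_poly_def)
qed

lemma hasse_formula_powers:
  fixes F :: "'a::field powering_formula"
  assumes "powering_formula n F" and "p \<in> formula_powers F"
  shows "hasse i k p \<in> mpoly.span (formula_powers F)"
proof -
  obtain l d j where ld: "(l, d) \<in> set F" and "j \<le> d" and p: "p = l ^ j"
    using assms(2) by (auto simp: formula_powers_def)
  have "affine_linear n l"
    using assms(1) ld by (auto simp: powering_formula_def)
  then obtain c where "hasse i k (l ^ j) = Const (of_nat (j choose k) * c ^ k) * l ^ (j - k)"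
    using hasse_affine_linear_power by blast
  moreover have "l ^ (j - k) \<in> formula_powers F"
    unfolding formula_powers_def using \<open>j \<le> d\<close>
    by (intro UN_I [OF ld]) (simp add: image_iff, intro bexI [of _ "j - k"], auto)
  ultimately show ?thesis
    unfolding p by (simp only: mpoly.span_scale mpoly.span_base)
qed

lemma prod_Var:
  assumes "finite A"
  shows "(\<Prod>i\<in>A. Var i) = Poly_Mapping.single (\<Sum>i\<in>A. Poly_Mapping.single i 1) (1::'a::comm_semiring_1)"
  using assms by induction (simp_all add: Var_def mult_single)

text \<open>Every monomial of the product is a monomial of \<open>g\<close> times the product of all
  variables in \<open>A\<close>. Cancellation can only remove monomials, so whichever one leads
  involves all of \<open>A\<close>.\<close>

lemma subset_keys_mult_prod_Var:
  fixes g :: "'a::comm_semiring_1 mpoly"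
  assumes "finite A" and "m \<in> Poly_Mapping.keys (g * (\<Prod>i\<in>A. Var i))"
  shows "A \<subseteq> Poly_Mapping.keys m"
proof
  fix i
  assume "i \<in> A"
  obtain m' where "m = m' + (\<Sum>i\<in>A. Poly_Mapping.single i 1)"
    using assms keys_mult [of g "\<Prod>i\<in>A. Var i"] by (auto simp: prod_Var split: if_splits)
  with \<open>i \<in> A\<close> \<open>finite A\<close> show "i \<in> Poly_Mapping.keys m"
    by (simp add: in_keys_iff lookup_add lookup_sum lookup_single when_def)
qed

theorem corollary6p9:
  fixes n :: nat and g :: "'a::field mpoly" and F :: "'a powering_formula"
  assumes "n \<ge> 1"
    and "g \<in> mpolys n" and "g \<noteq> 0"
    and "powering_formula n F"
    and "computed_poly F = g * (\<Prod>i = 1..n. Var i)"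
  shows "formula_size n F \<ge> 2 ^ n"
proof -
  let ?f = "computed_poly F"
  have "(\<Prod>i = 1..n. Var i :: 'a mpoly) \<noteq> 0"
    by (simp add: prod_Var flip: keys_eq_empty)
  \<comment> \<open>Polynomials over a field have no zero divisors.\<close>
  with assms(3,5) have "?f \<noteq> 0"
    by simp
  then have "lead_monom ?f \<in> Poly_Mapping.keys ?f"
    by simp
  then have "{1..n} \<subseteq> Poly_Mapping.keys (lead_monom ?f)"
    unfolding assms(5) by (rule subset_keys_mult_prod_Var [rotated]) simp
  then have "n \<le> card (Poly_Mapping.keys (lead_monom ?f))"
    using card_mono [of "Poly_Mapping.keys (lead_monom ?f)" "{1..n}"] by simp
  then have "2 ^ n \<le> (2::nat) ^ card (Poly_Mapping.keys (lead_monom ?f))"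
    by simp
  also have "\<dots> \<le> card (formula_powers F)"
    using finite_formula_powers hasse_formula_powers [OF assms(4)] computed_poly_in_span \<open>?f \<noteq> 0\<close>
    by (rule power_card_le_if_hasse_closed)
  also have "\<dots> \<le> (\<Sum>(l, d) \<leftarrow> F. d + 1)"
    by (rule card_formula_powers)
  \<comment> \<open>The factor \<open>n\<close> of the size is at least 1.\<close>
  also have "\<dots> \<le> formula_size n F"
    using \<open>n \<ge> 1\<close> by (simp add: formula_size_def)
  finally show ?thesis .
qed

end
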